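(* Let $n\ge 1$ and let $A,B\subset\mathbb{R}^n$ be convex bodies. (1) If $|A+K|\le |B+K|$ for every convex body $K\subset\mathbb{R}^n$, then there exists $x_0\in\mathbb{R}^n$ such that $A\subseteq B+x_0$. (2) Moreover, if $|A+\Delta|\le |B+\Delta|$ for every (non-degenerate) simplex $\Delta\subset\mathbb{R}^n$, then there exists $x_0\in\mathbb{R}^n$ such that $A\subseteq B+x_0$.
   Context: A convex body in $\mathbb{R}^n$ is a compact convex set with non-empty interior; simplices here are $n$-dimensional, i.e. are themselves convex bodies. $|\cdot|$ denotes $n$-dimensional volume and $A+K$ is the Minkowski sum. *)

theory Defs
  imports "HOL-Analysis.Analysis"
begin

definition convex_body :: "'a::euclidean_space set \<Rightarrow> bool"
  where "convex_body K \<longleftrightarrow> compact K \<and> convex K \<and> interior K \<noteq> {}"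

end

theory Submission
  imports Defs
begin

text \<open>Let $h_A, h_B$ be the support functions and $\varphi = h_A - h_B$. If $A$ is not contained in a
translate of $B$, no linear functional dominates $\varphi$, so a hyperplane separation and a
Caratheodory argument yield $n+1$ outer normals $w_i$ of a simplex with $\sum w_i = 0$ and
$\sum \varphi(w_i) > 0$. For a large multiple $D$ of that simplex the first-order behaviour of
$|A+D|$ is governed by $\sum h_A(w_i)$: the body $B+D$ lies in the circumscribed simplex homothetic
to $D$, while $A+D$ contains $n+1$ translates of $D$, each touching one facet of its circumscribed simplex,
and these exhaust the simplex up to lower order. Hence $|A+D| > |B+D|$ eventually.\<close>

section \<open>Support functions\<close>

definition supp_fun :: "'a::euclidean_space set \<Rightarrow> 'a \<Rightarrow> real"
  where "supp_fun K u = (SUP x\<in>K. x \<bullet> u)"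

lemma supp_fun_attained:
  assumes "compact K" "K \<noteq> {}"
  obtains a where "a \<in> K" "a \<bullet> u = supp_fun K u" "\<And>x. x \<in> K \<Longrightarrow> x \<bullet> u \<le> supp_fun K u"
proof -
  have "continuous_on K (\<lambda>x. x \<bullet> u)"
    by (intro continuous_intros)
  from continuous_attains_sup[OF assms this]
  obtain a where a: "a \<in> K" "\<And>x. x \<in> K \<Longrightarrow> x \<bullet> u \<le> a \<bullet> u"
    by blast
  then have "supp_fun K u = a \<bullet> u"
    unfolding supp_fun_def by (intro cSup_eq_maximum) auto
  with a that show ?thesis by simp
qed

lemma supp_fun_upper:
  assumes "compact K" "x \<in> K"
  shows "x \<bullet> u \<le> supp_fun K u"
  using assms by (metis empty_iff supp_fun_attained)

lemma supp_fun_scaleR: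
  assumes "compact K" "K \<noteq> {}" "0 \<le> c"
  shows "supp_fun K (c *\<^sub>R u) = c * supp_fun K u"
proof (rule antisym)
  show "supp_fun K (c *\<^sub>R u) \<le> c * supp_fun K u"
    using assms by (metis supp_fun_attained inner_scaleR_right mult_left_mono supp_fun_upper)
  obtain a where "a \<in> K" "a \<bullet> u = supp_fun K u"
    using assms supp_fun_attained by metis
  then show "c * supp_fun K u \<le> supp_fun K (c *\<^sub>R u)"
    using supp_fun_upper[OF assms(1), of a "c *\<^sub>R u"] by simp
qed

text \<open>A supremum of linear functionals is convex, and a finite convex function on the whole
  space is continuous.\<close>

lemma continuous_on_supp_fun:
  assumes "compact K" "K \<noteq> {}"
  shows "continuous_on UNIV (supp_fun K)"
proof (rule convex_on_continuous)
  show "convex_on UNIV (supp_fun K)"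
  proof (rule convex_onI)
    fix t :: real and u v :: 'a
    assume t: "0 < t" "t < 1"
    obtain a where a: "a \<in> K" "a \<bullet> ((1 - t) *\<^sub>R u + t *\<^sub>R v) = supp_fun K ((1 - t) *\<^sub>R u + t *\<^sub>R v)"
      using assms supp_fun_attained by metis
    have "(1 - t) * (a \<bullet> u) \<le> (1 - t) * supp_fun K u" "t * (a \<bullet> v) \<le> t * supp_fun K v"
      using t a assms by (auto intro!: mult_left_mono supp_fun_upper)
    then show "supp_fun K ((1 - t) *\<^sub>R u + t *\<^sub>R v) \<le> (1 - t) * supp_fun K u + t * supp_fun K v"
      using a(2) by (simp add: inner_add_right)
  qed auto
qed auto

text \<open>A closed convex set is the intersection of its supporting half-spaces: if
  \<open>y - x\<close> lay outside \<open>B\<close>, the normal of a strictly separating hyperplane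
  would violate \<open>le\<close>.\<close>

lemma subset_translate_if_supp_fun_le:
  assumes "compact A" "compact B" "convex B" "B \<noteq> {}"
    and le: "\<And>u. supp_fun A u \<le> supp_fun B u + x \<bullet> u"
  shows "A \<subseteq> (\<lambda>b. b + x) ` B"
proof
  fix y assume y: "y \<in> A"
  have "y - x \<in> B"
  proof (rule ccontr)
    assume "y - x \<notin> B"
    then obtain a b where ab: "a \<bullet> (y - x) < b" "\<And>z. z \<in> B \<Longrightarrow> b < a \<bullet> z"
      using separating_hyperplane_closed_point[of B "y - x"] assms compact_imp_closed by metis
    obtain z where "z \<in> B" "z \<bullet> (- a) = supp_fun B (- a)"
      using assms supp_fun_attained by metis
    then have "supp_fun B (- a) < - b"
      using ab(2)[of z] by (simp add: inner_commute)
    moreover have "y \<bullet> (- a) \<le> supp_fun A (- a)"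
      using y assms by (intro supp_fun_upper)
    ultimately show False
      using ab(1) le[of "- a"] by (simp add: inner_diff_right inner_commute)
  qed
  then show "y \<in> (\<lambda>b. b + x) ` B"
    by (intro image_eqI[of _ _ "y - x"]) auto
qed

section \<open>Balanced normals with positive weighted sum\<close>

text \<open>If the convex hull of the graph of \<open>\<phi>\<close> missed the open vertical ray
  above the origin, a hyperplane separating the two would be the graph of a linear majorant of
  \<open>\<phi>\<close>. So the hull contains some \<open>(0, t)\<close> with \<open>0 < t\<close>,
  and the coefficients of this convex combination are the weights.\<close>

lemma not_linear_majorized_imp_balanced_weights:
  fixes \<phi> :: "'a::euclidean_space \<Rightarrow> real"
  assumes hom: "\<And>c u. 0 \<le> c \<Longrightarrow> \<phi> (c *\<^sub>R u) = c * \<phi> u"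
    and no: "\<nexists>x. \<forall>u. \<phi> u \<le> x \<bullet> u"
  obtains T l where "finite T" "\<forall>v\<in>T. 0 \<le> l v" "(\<Sum>v\<in>T. l v *\<^sub>R v) = 0"
    "0 < (\<Sum>v\<in>T. l v * \<phi> v)"
proof -
  define S where "S = range (\<lambda>u. (u, \<phi> u))"
  define R where "R = {0::'a} \<times> {0::real<..}"
  have "convex hull S \<inter> R \<noteq> {}"
  proof
    assume "convex hull S \<inter> R = {}"
    moreover have "convex R" "R \<noteq> {}" "convex hull S \<noteq> {}"
      unfolding R_def S_def by (auto intro: convex_Times)
    ultimately obtain p b where p: "p \<noteq> 0" "\<forall>z\<in>convex hull S. p \<bullet> z \<le> b" "\<forall>z\<in>R. b \<le> p \<bullet> z"
      using separating_hyperplane_sets[of "convex hull S" R] convex_convex_hull by blast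
    obtain a \<beta> where ab: "p = (a, \<beta>)" by (cases p)
    have "(u, \<phi> u) \<in> convex hull S" for u
      unfolding S_def by (meson hull_inc rangeI)
    then have S: "a \<bullet> u + \<beta> * \<phi> u \<le> b" for u
      using p(2) ab by fastforce
    have R: "b \<le> \<beta> * t" if "0 < t" for t
      using p(3) that ab unfolding R_def by fastforce
    have "0 \<le> b"
      using S[of 0] hom[of 0 0] by simp
    then have "0 \<le> \<beta>"
      using R[of 1] by simp
    \<comment> \<open>Letting the height on the ray tend to 0 shows that the hyperplane may be taken
      through the origin.\<close>
    have "b \<le> 0"
      by (rule tendsto_lowerbound[of "\<lambda>t. \<beta> * t" 0 "at_right 0"])
        (auto intro!: tendsto_eq_intros eventually_at_right_less[THEN eventually_mono] R)
    then have S': "a \<bullet> u + \<beta> * \<phi> u \<le> 0" for u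
      using S[of u] by simp
    show False
    \<comment> \<open>A vertical hyperplane is impossible because the graph lies over the whole
      space; a non-vertical one yields the forbidden majorant after division by
      \<open>\<beta>\<close>.\<close>
    proof (cases "\<beta> = 0")
      case True
      then have "a = 0"
        using S'[of a] by (metis True add_0_right inner_gt_zero_iff mult_zero_left not_le)
      with True p(1) ab show False
        by (simp add: zero_prod_def)
    next
      case False
      then have "\<phi> u \<le> (- (a /\<^sub>R \<beta>)) \<bullet> u" for u
        using S'[of u] \<open>0 \<le> \<beta>\<close> by (simp add: field_simps)
      with no show False by blast
    qed
  qed
  then obtain t where t: "0 < t" "(0, t) \<in> convex hull S"
    unfolding R_def by auto
  then obtain F w where F: "finite F" "F \<subseteq> S" "\<forall>z\<in>F. 0 \<le> w z"
      "(\<Sum>z\<in>F. w z *\<^sub>R z) = (0, t)"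
    unfolding convex_hull_explicit by blast
  \<comment> \<open>Distinct graph points have distinct first components, so the weights can be
    indexed by vectors instead.\<close>
  have snd: "snd z = \<phi> (fst z)" if "z \<in> F" for z
    using that F(2) unfolding S_def by auto
  then have inj: "inj_on fst F"
    by (intro inj_onI) (metis prod_eqI)
  define l where "l v = w (v, \<phi> v)" for v
  have l: "l (fst z) = w z" if "z \<in> F" for z
    using snd[OF that] unfolding l_def by (metis prod.collapse)
  show thesis
  proof
    show "finite (fst ` F)" using F by simp
    show "\<forall>v\<in>fst ` F. 0 \<le> l v"
      using F(3) l by auto
    have "(\<Sum>v\<in>fst ` F. l v *\<^sub>R v) = fst (\<Sum>z\<in>F. w z *\<^sub>R z)"
      by (simp add: sum.reindex[OF inj] l fst_sum)
    then show "(\<Sum>v\<in>fst ` F. l v *\<^sub>R v) = 0"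
      using F by simp
    have "(\<Sum>v\<in>fst ` F. l v * \<phi> v) = snd (\<Sum>z\<in>F. w z *\<^sub>R z)"
      by (simp add: sum.reindex[OF inj] l snd_sum snd)
    then show "0 < (\<Sum>v\<in>fst ` F. l v * \<phi> v)"
      using F t by simp
  qed
qed

lemma independent_balanced_weights:
  fixes \<phi> :: "'a::euclidean_space \<Rightarrow> real"
  assumes T0: "finite T0" "\<forall>v\<in>T0. 0 \<le> l0 v" "(\<Sum>v\<in>T0. l0 v *\<^sub>R v) = 0"
    "0 < (\<Sum>v\<in>T0. l0 v * \<phi> v)"
  obtains W l v0 where "independent W" "v0 \<notin> W" "\<forall>v\<in>insert v0 W. 0 < l v"
    "l v0 *\<^sub>R v0 + (\<Sum>v\<in>W. l v *\<^sub>R v) = 0" "0 < l v0 * \<phi> v0 + (\<Sum>v\<in>W. l v * \<phi> v)"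
proof -
  \<comment> \<open>A support of minimal size: along any linear relation avoiding one vector, the weights
    could be moved until one of them vanishes without decreasing the \<open>\<phi>\<close>-sum.\<close>
  define P where "P T l \<longleftrightarrow> finite T \<and> (\<forall>v\<in>T. 0 \<le> l v) \<and> (\<Sum>v\<in>T. l v *\<^sub>R v) = 0 \<and>
    0 < (\<Sum>v\<in>T. l v * \<phi> v)" for T :: "'a set" and l :: "'a \<Rightarrow> real"
  have "\<exists>T. (\<exists>l. P T l) \<and> (\<forall>U. (\<exists>l. P U l) \<longrightarrow> card T \<le> card U)"
    using T0 by (intro ex_has_least_nat[of "\<lambda>T. \<exists>l. P T l" T0 card]) (auto simp: P_def)
  then obtain T l where P: "P T l" and min: "\<And>U l. P U l \<Longrightarrow> card T \<le> card U"
    by blast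
  have fin: "finite T" and l: "\<And>v. v \<in> T \<Longrightarrow> 0 \<le> l v" and lv: "(\<Sum>v\<in>T. l v *\<^sub>R v) = 0"
    and lphi: "0 < (\<Sum>v\<in>T. l v * \<phi> v)"
    using P unfolding P_def by auto
  \<comment> \<open>By minimality this holds for every admissible weighting on \<open>T\<close>, not
    only for \<open>l\<close>; each contradiction below comes from a weighting with a zero.\<close>
  have full: "0 < m v" if m: "P T m" "v \<in> T" for m v
  proof (rule ccontr)
    assume "\<not> 0 < m v"
    with m have 0: "m v = 0"
      unfolding P_def by (simp add: order_less_le)
    have "P (T - {v}) m"
      using m 0 unfolding P_def by (simp add: sum_diff1)
    then have "card T \<le> card (T - {v})" by (rule min)
    with m fin show False
      by (metis card_Diff1_less leD)
  qed
  have "T \<noteq> {}"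
    using lphi by auto
  then obtain v0 where v0: "v0 \<in> T" by auto
  have reduce: False
    if m: "(\<Sum>v\<in>T. m v *\<^sub>R v) = 0" "0 \<le> (\<Sum>v\<in>T. m v * \<phi> v)" "\<exists>v\<in>T. m v < 0" for m
  proof -
    define N where "N = {v\<in>T. m v < 0}"
    \<comment> \<open>The largest step in direction \<open>m\<close> that keeps all weights
      non-negative; it is attained at \<open>v1\<close>, whose weight drops to zero.\<close>
    define t where "t = Min ((\<lambda>v. l v / (- m v)) ` N)"
    have N: "finite N" "N \<noteq> {}"
      using fin m(3) unfolding N_def by auto
    then have "t \<in> (\<lambda>v. l v / (- m v)) ` N"
      unfolding t_def by (intro Min_in) auto
    then obtain v1 where v1: "v1 \<in> N" "t = l v1 / (- m v1)" by auto
    have t0: "0 \<le> t"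
      using v1 l unfolding N_def by (auto intro: divide_nonneg_neg)
    have tle: "t \<le> l v / (- m v)" if "v \<in> N" for v
      unfolding t_def using that N by (intro Min_le) auto
    have nonneg: "0 \<le> l v + t * m v" if "v \<in> T" for v
    proof (cases "m v < 0")
      case True
      with tle[of v] that have "t \<le> l v / (- m v)"
        unfolding N_def by blast
      with True have "t * (- m v) \<le> l v"
        by (metis pos_le_divide_eq neg_0_less_iff_less)
      then show ?thesis by simp
    next
      case False
      with l[OF that] t0 show ?thesis by simp
    qed
    have "(\<Sum>v\<in>T. (l v + t * m v) *\<^sub>R v) = 0"
      using lv m(1) by (simp add: scaleR_left_distrib sum.distrib flip: scaleR_scaleR scaleR_sum_right)
    moreover have "(\<Sum>v\<in>T. (l v + t * m v) * \<phi> v) = (\<Sum>v\<in>T. l v * \<phi> v) + t * (\<Sum>v\<in>T. m v * \<phi> v)"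
      by (simp add: distrib_right sum.distrib sum_distrib_left mult.assoc)
    then have "0 < (\<Sum>v\<in>T. (l v + t * m v) * \<phi> v)"
      using lphi t0 m(2) by (simp add: add_pos_nonneg)
    ultimately have "P T (\<lambda>v. l v + t * m v)"
      unfolding P_def using fin nonneg by auto
    then have "0 < l v1 + t * m v1"
      using full[of _ v1] v1 unfolding N_def by blast
    moreover have "l v1 + t * m v1 = 0"
      using v1 unfolding N_def by simp
    ultimately show False by simp
  qed
  have indep: "independent (T - {v0})"
  proof (rule ccontr)
    assume "\<not> independent (T - {v0})"
    then obtain m0 u where m0: "(\<Sum>v\<in>T - {v0}. m0 v *\<^sub>R v) = 0" "u \<in> T - {v0}" "m0 u \<noteq> 0"
      using fin dependent_finite[of "T - {v0}"] by auto
    define m where "m v = (if v = v0 then 0 else m0 v)" for v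
    have sum_m: "(\<Sum>v\<in>T. m v *\<^sub>R v) = 0"
    proof -
      have "(\<Sum>v\<in>T. m v *\<^sub>R v) = m v0 *\<^sub>R v0 + (\<Sum>v\<in>T - {v0}. m v *\<^sub>R v)"
        using fin v0 by (simp add: sum.remove)
      also have "(\<Sum>v\<in>T - {v0}. m v *\<^sub>R v) = (\<Sum>v\<in>T - {v0}. m0 v *\<^sub>R v)"
        by (intro sum.cong) (auto simp: m_def)
      finally show ?thesis using m0 by (simp add: m_def)
    qed
    \<comment> \<open>The sign is chosen so that moving along \<open>n\<close> does not decrease the
      \<open>\<phi>\<close>-sum; \<open>reduce\<close> then forces \<open>n\<close> to be
      non-negative on \<open>T\<close>.\<close>
    define n where "n = (if 0 \<le> (\<Sum>v\<in>T. m v * \<phi> v) then m else (\<lambda>v. - m v))"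
    have n: "(\<Sum>v\<in>T. n v *\<^sub>R v) = 0" "0 \<le> (\<Sum>v\<in>T. n v * \<phi> v)" "n v0 = 0" "n u \<noteq> 0" "u \<in> T"
      using sum_m m0 by (auto simp: n_def sum_negf m_def)
    have nn: "0 \<le> n v" if "v \<in> T" for v
      using reduce[of n] n that by force
    \<comment> \<open>With a positive sum \<open>n\<close> would itself be admissible although it
      vanishes at \<open>v0\<close>. With sum zero \<open>- n\<close> is also a permitted direction,
      and its negative entry at \<open>u\<close> contradicts \<open>reduce\<close>.\<close>
    have "(\<Sum>v\<in>T. n v * \<phi> v) = 0"
    proof (rule ccontr)
      assume "(\<Sum>v\<in>T. n v * \<phi> v) \<noteq> 0"
      then have "P T n"
        using n nn fin unfolding P_def by simp
      then show False
        using full[of n v0] v0 n by simp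
    qed
    then show False
      using n nn[of u] by (intro reduce[of "\<lambda>v. - n v"]) (auto simp: sum_negf intro!: bexI[of _ u])
  qed
  show thesis
  proof
    show "independent (T - {v0})" by fact
    show "v0 \<notin> T - {v0}" by simp
    show "\<forall>v\<in>insert v0 (T - {v0}). 0 < l v"
      using full[OF P] v0 by auto
    show "l v0 *\<^sub>R v0 + (\<Sum>v\<in>T - {v0}. l v *\<^sub>R v) = 0"
      "0 < l v0 * \<phi> v0 + (\<Sum>v\<in>T - {v0}. l v * \<phi> v)"
      using lv lphi fin v0 by (simp_all add: sum.remove)
  qed
qed

lemma injective_linear_positive_sum:
  fixes \<phi> :: "'a::euclidean_space \<Rightarrow> real"
  assumes hom: "\<And>c u. 0 \<le> c \<Longrightarrow> \<phi> (c *\<^sub>R u) = c * \<phi> u"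
    and cont: "continuous_on UNIV \<phi>"
    and W: "independent W" "v0 \<notin> W" "\<forall>v\<in>insert v0 W. 0 < l v"
    "l v0 *\<^sub>R v0 + (\<Sum>v\<in>W. l v *\<^sub>R v) = 0" "0 < l v0 * \<phi> v0 + (\<Sum>v\<in>W. l v * \<phi> v)"
  obtains g :: "'a \<Rightarrow> 'a" where "linear g" "inj g" "0 < \<phi> (g One) + (\<Sum>i\<in>Basis. \<phi> (- g i))"
proof -
  \<comment> \<open>Complete \<open>W\<close> to a basis; giving the new vectors a small weight \<open>e\<close> makes \<open>g\<close> invertible
    while, by continuity, keeping the sum positive.\<close>
  obtain B where B: "W \<subseteq> B" "independent B" "UNIV \<subseteq> span B"
    by (rule maximal_independent_subset_extend[OF subset_UNIV W(1)])
  have finB: "finite B"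
    using B(2) by (rule finiteI_independent)
  have cardB: "card B = DIM('a)"
    using basis_card_eq_dim[OF subset_UNIV B(3,2)] by simp
  have finW: "finite W"
    using finB B finite_subset by blast
  obtain \<pi> where \<pi>: "bij_betw \<pi> (Basis :: 'a set) B"
    using finite_same_card_bij[OF finite_Basis finB] cardB by auto
  \<comment> \<open>The target sum as a function of the weight \<open>e\<close> of the added
    vectors: the first argument of \<open>\<phi>\<close> is what the vector closing the relation
    becomes. At \<open>e = 0\<close> it is \<open>l v0 *\<^sub>R v0\<close>, so \<open>f 0\<close>
    is the given positive sum.\<close>
  define f where "f e = \<phi> (- (\<Sum>v\<in>W. l v *\<^sub>R v) - e *\<^sub>R (\<Sum>v\<in>B - W. v)) +
     ((\<Sum>v\<in>W. l v * \<phi> v) + e * (\<Sum>v\<in>B - W. \<phi> v))" for e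
  have "continuous_on UNIV f"
    unfolding f_def
    by (intro continuous_intros continuous_on_compose2[OF cont]) auto
  then have "(f \<longlongrightarrow> f 0) (at_right 0)"
    by (simp add: continuous_on_eq_continuous_at isCont_def filterlim_at_split)
  moreover have "- (\<Sum>v\<in>W. l v *\<^sub>R v) = l v0 *\<^sub>R v0"
    using W(4) by (metis minus_unique add.commute)
  then have "0 < f 0"
    using W(5) W(3) by (simp add: f_def hom)
  ultimately have "\<forall>\<^sub>F e in at_right 0. 0 < f e"
    by (rule order_tendstoD)
  moreover have "\<forall>\<^sub>F e in at_right 0. (0::real) < e"
    by (rule eventually_at_right_less)
  ultimately have "\<forall>\<^sub>F e in at_right 0. 0 < f e \<and> 0 < e"
    by (rule eventually_conj)
  then obtain e where e: "0 < f e" "0 < e"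
    using eventually_happens[of _ "at_right (0::real)"] by auto
  define d where "d v = (if v \<in> W then l v else e)" for v
  have d: "0 < d v" for v
    using e W(3) by (simp add: d_def)
  \<comment> \<open>The sign makes \<open>- g i\<close> the weighted basis vectors. By linearity
    \<open>g One\<close> is then the vector that closes the relation, and these will be the outer
    normals of the simplex.\<close>
  obtain g :: "'a \<Rightarrow> 'a" where g: "linear g" "\<And>i. i \<in> Basis \<Longrightarrow> g i = - (d (\<pi> i) *\<^sub>R \<pi> i)"
    using linear_independent_extend[OF independent_Basis, of "\<lambda>i. - (d (\<pi> i) *\<^sub>R \<pi> i)"] by blast
  have split: "(\<Sum>i\<in>Basis. h (\<pi> i)) = sum h W + sum h (B - W)" for h :: "'a \<Rightarrow> 'b::real_vector"
    using sum.reindex_bij_betw[OF \<pi>, of h] sum.subset_diff[OF B(1) finB, of h] by (simp add: add.commute)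
  show thesis
  proof
    show "linear g" by fact
    have "B \<subseteq> range g"
    proof
      fix v assume "v \<in> B"
      then obtain i where i: "i \<in> Basis" "v = \<pi> i"
        using \<pi> by (auto simp: bij_betw_def)
      have "g (- (i /\<^sub>R d v)) = v"
        using g(2)[OF i(1)] i(2) d[of v] by (simp add: linear_neg[OF g(1)] linear_scale[OF g(1)])
      then show "v \<in> range g" by (metis rangeI)
    qed
    then have "span B \<subseteq> range g"
      using g(1) by (simp add: linear_subspace_image span_minimal)
    then show "inj g"
      using B(3) g(1) by (auto intro: linear_surjective_imp_injective)
    have "g One = - (\<Sum>i\<in>Basis. d (\<pi> i) *\<^sub>R \<pi> i)"
      using g(2) by (simp add: linear_sum[OF g(1)] sum_negf)
    also have "(\<Sum>i\<in>Basis. d (\<pi> i) *\<^sub>R \<pi> i) = (\<Sum>v\<in>W. l v *\<^sub>R v) + e *\<^sub>R (\<Sum>v\<in>B - W. v)"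
      by (rule trans[OF split[of "\<lambda>v. d v *\<^sub>R v"]]) (simp add: d_def scaleR_sum_right)
    finally have 1: "g One = - (\<Sum>v\<in>W. l v *\<^sub>R v) - e *\<^sub>R (\<Sum>v\<in>B - W. v)" by simp
    have "(\<Sum>i\<in>Basis. \<phi> (- g i)) = (\<Sum>i\<in>Basis. d (\<pi> i) * \<phi> (\<pi> i))"
      using g(2) d hom by (intro sum.cong) (auto simp: less_imp_le)
    also have "\<dots> = (\<Sum>v\<in>W. l v * \<phi> v) + e * (\<Sum>v\<in>B - W. \<phi> v)"
      by (rule trans[OF split[of "\<lambda>v. d v * \<phi> v"]]) (simp add: d_def sum_distrib_left)
    finally show "0 < \<phi> (g One) + (\<Sum>i\<in>Basis. \<phi> (- g i))"
      using e(1) 1 unfolding f_def by simp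
  qed
qed

section \<open>Simplices with prescribed facet normals and their volume\<close>

text \<open>Full affine dimension makes the relative interior, non-empty for a non-empty convex set,
  the interior.\<close>

lemma simplex_imp_convex_body:
  fixes D :: "'a::euclidean_space set"
  assumes "int DIM('a) simplex D"
  shows "convex_body D"
proof -
  have "D \<noteq> {}" "convex D" "aff_dim D = int DIM('a)"
    using assms aff_dim_simplex convex_simplex by auto
  then show ?thesis
    using assms by (simp add: convex_body_def compact_simplex interior_rel_interior_gen rel_interior_eq_empty)
qed

text \<open>The outer normals are \<open>- g i\<close> for \<open>i \<in> Basis\<close> together
  with \<open>g One\<close>; for linear \<open>g\<close> they sum to zero. Encoding them by one map
  turns facts about these simplices into facts about the standard simplex.\<close>

definition halfspace_simplex :: "('a::euclidean_space \<Rightarrow> 'a) \<Rightarrow> ('a \<Rightarrow> real) \<Rightarrow> real \<Rightarrow> 'a set"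
  where "halfspace_simplex g b c = {x. (\<forall>i\<in>Basis. b i \<le> x \<bullet> g i) \<and> x \<bullet> g One \<le> c}"

lemma inner_linear_One:
  assumes "linear g"
  shows "x \<bullet> g One = (\<Sum>i\<in>Basis. x \<bullet> g i)"
  using assms by (simp add: linear_sum inner_sum_right)

text \<open>The scaled adjoint of \<open>g\<close> turns the values \<open>x \<bullet> g i\<close>
  into coordinates, so the set is the preimage of the standard simplex under a linear
  bijection.\<close>

lemma simplex_halfspace_simplex:
  fixes g :: "'a::euclidean_space \<Rightarrow> 'a"
  assumes g: "linear g" "inj g" and t: "0 < t"
  shows "int DIM('a) simplex halfspace_simplex g (\<lambda>_. 0) t"
proof -
  define L where "L = (\<lambda>x. adjoint g x /\<^sub>R t)"
  have L: "linear L"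
    unfolding L_def using adjoint_linear[OF g(1)] by (simp add: linear_compose_scale_right)
  have "inj (adjoint g)"
    using g by (simp add: linear_injective_imp_surjective)
  then have "inj L"
    unfolding L_def using t by (auto simp: inj_def)
  then have "bij L"
    using L by (simp add: bij_def linear_injective_imp_surjective)
  have Li: "L x \<bullet> i = (x \<bullet> g i) / t" for x i
    unfolding L_def using adjoint_works[OF g(1), of i x]
    by (simp add: inner_commute divide_inverse_commute)
  obtain K where K: "linear K" "K \<circ> L = id" "L \<circ> K = id"
    using linear_injective_isomorphism[OF L \<open>inj L\<close>] by (metis ext comp_apply id_apply)
  have "inj K"
    using K(3) by (metis inj_on_id inj_on_imageI2)
  have "halfspace_simplex g (\<lambda>_. 0) t = L -` (convex hull (insert 0 Basis))"
    unfolding halfspace_simplex_def std_simplex vimage_def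
    using t by (simp add: Li inner_linear_One[OF g(1)] zero_le_divide_iff flip: sum_divide_distrib)
  also have "\<dots> = K ` (convex hull (insert 0 Basis))"
    using K by (metis \<open>bij L\<close> bij_vimage_eq_inv_image inv_unique_comp)
  also have "\<dots> = convex hull (insert 0 (K ` Basis))"
    by (simp add: convex_hull_linear_image[OF K(1)] linear_0[OF K(1)])
  finally have eq: "halfspace_simplex g (\<lambda>_. 0) t = convex hull (insert 0 (K ` Basis))" .
  have indep: "independent (K ` Basis)"
    by (rule linear_independent_injective_image[OF K(1) independent_Basis])
      (use \<open>inj K\<close> inj_on_subset in blast)
  then have "0 \<notin> K ` Basis"
    using dependent_zero by blast
  then have "card (insert 0 (K ` Basis)) = DIM('a) + 1"
    using \<open>inj K\<close> by (simp add: card_image inj_on_subset)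
  then show ?thesis
    unfolding eq using indep by (intro simplex_convex_hull) (auto dest: affine_dependent_imp_dependent2)
qed

text \<open>The translation \<open>y\<close> is the vertex at which all the lower constraints are
  tight, found by solving \<open>y \<bullet> g i = b i\<close> with the surjective adjoint. There
  \<open>y \<bullet> g One\<close> equals \<open>sum b Basis\<close>, so the remaining slack
  \<open>c - sum b Basis\<close> is the scaling ratio.\<close>

lemma halfspace_simplex_affine:
  fixes g :: "'a::euclidean_space \<Rightarrow> 'a"
  assumes g: "linear g" "inj g" and lt: "sum b Basis < c"
  obtains y where "halfspace_simplex g b c =
    (\<lambda>x. (c - sum b Basis) *\<^sub>R x + y) ` halfspace_simplex g (\<lambda>_. 0) 1"
proof -
  define r where "r = c - sum b Basis"
  have r: "0 < r"
    using lt by (simp add: r_def)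
  have "surj (adjoint g)"
    using g by simp
  then obtain y where "adjoint g y = (\<Sum>i\<in>Basis. b i *\<^sub>R i)"
    by (metis surjD)
  then have y: "y \<bullet> g i = b i" if "i \<in> Basis" for i
    using that adjoint_works[OF g(1), of i y]
    by (simp add: inner_commute inner_sum_right inner_Basis if_distrib cong: if_cong)
  then have y1: "y \<bullet> g One = sum b Basis"
    by (simp add: inner_linear_One[OF g(1)])
  have c: "c = r + sum b Basis"
    by (simp add: r_def)
  have div: "((x - y) /\<^sub>R r) \<bullet> v = (x \<bullet> v - y \<bullet> v) / r" for x v
    by (simp add: inner_diff_left divide_inverse_commute)
  have "x \<in> halfspace_simplex g b c \<longleftrightarrow> (x - y) /\<^sub>R r \<in> halfspace_simplex g (\<lambda>_. 0) 1" for x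
    unfolding halfspace_simplex_def mem_Collect_eq div c
    using r y y1 by (simp add: zero_le_divide_iff divide_le_eq diff_le_eq)
  moreover have "x = r *\<^sub>R ((x - y) /\<^sub>R r) + y" "((r *\<^sub>R x + y) - y) /\<^sub>R r = x" for x
    using r by simp_all
  ultimately have "halfspace_simplex g b c = (\<lambda>x. r *\<^sub>R x + y) ` halfspace_simplex g (\<lambda>_. 0) 1"
    by (metis (no_types, lifting) image_iff subsetI subset_antisym)
  then show thesis
    using that by (simp add: r_def)
qed

lemma
  fixes g :: "'a::euclidean_space \<Rightarrow> 'a"
  assumes g: "linear g" "inj g" and lt: "sum b Basis < c"
  shows compact_halfspace_simplex: "compact (halfspace_simplex g b c)"
    and measure_halfspace_simplex: "measure lebesgue (halfspace_simplex g b c) =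
      (c - sum b Basis) ^ DIM('a) * measure lebesgue (halfspace_simplex g (\<lambda>_. 0) 1)"
proof -
  obtain y where y: "halfspace_simplex g b c =
    (\<lambda>x. (c - sum b Basis) *\<^sub>R x + y) ` halfspace_simplex g (\<lambda>_. 0) 1"
    using halfspace_simplex_affine[OF assms] .
  have "compact (halfspace_simplex g (\<lambda>_. 0) 1)"
    using simplex_halfspace_simplex[OF g zero_less_one] by (rule compact_simplex)
  then show "compact (halfspace_simplex g b c)"
    unfolding y by (intro compact_continuous_image continuous_intros)
  show "measure lebesgue (halfspace_simplex g b c) =
      (c - sum b Basis) ^ DIM('a) * measure lebesgue (halfspace_simplex g (\<lambda>_. 0) 1)"
    unfolding y using lt by (simp add: measure_lebesgue_affine)
qed

lemma measure_halfspace_simplex_pos: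
  fixes g :: "'a::euclidean_space \<Rightarrow> 'a"
  assumes "linear g" "inj g"
  shows "0 < measure lebesgue (halfspace_simplex g (\<lambda>_. 0) 1)"
proof -
  have "convex_body (halfspace_simplex g (\<lambda>_. 0) 1)"
    using assms by (intro simplex_imp_convex_body simplex_halfspace_simplex) auto
  then have "measure lebesgue (halfspace_simplex g (\<lambda>_. 0) 1) \<noteq> 0"
    unfolding convex_body_def
    by (metis lmeasurable_compact negligible_convex_interior negligible_iff_measure)
  then show ?thesis
    by (simp add: less_le)
qed

section \<open>Two-sided volume bounds for the sum of a compact set and a simplex\<close>

lemma compact_set_plus:
  fixes A B :: "'a::real_normed_vector set"
  assumes "compact A" "compact B"
  shows "compact (A + B)"
proof -
  have "A + B = {x + y |x y. x \<in> A \<and> y \<in> B}"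
    by (auto simp: set_plus_def)
  then show ?thesis
    using compact_sums[OF assms] by simp
qed

text \<open>The normals cancel, so it suffices to add the support inequalities at a single point of
  \<open>K\<close>. This keeps the circumscribed simplex of \<open>K\<close> plus a simplex
  non-degenerate.\<close>

lemma supp_fun_sum_nonneg:
  assumes "linear g" "compact K" "K \<noteq> {}"
  shows "0 \<le> supp_fun K (g One) + (\<Sum>i\<in>Basis. supp_fun K (- g i))"
proof -
  obtain x where x: "x \<in> K" using assms by auto
  have "x \<bullet> g One + (\<Sum>i\<in>Basis. x \<bullet> (- g i)) \<le> supp_fun K (g One) + (\<Sum>i\<in>Basis. supp_fun K (- g i))"
    using assms x by (intro add_mono sum_mono supp_fun_upper)
  then show ?thesis
    by (simp add: inner_linear_One[OF assms(1)] sum_negf)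
qed

text \<open>Support values add under Minkowski sums, so the sum lies in the simplex
  \<open>?Q\<close> with the same normals, whose scaling ratio is \<open>t\<close> plus the sum of
  the support values of \<open>K\<close>.\<close>

lemma measure_plus_simplex_le:
  fixes g :: "'a::euclidean_space \<Rightarrow> 'a"
  assumes g: "linear g" "inj g" and K: "compact K" "K \<noteq> {}" and t: "0 < t"
  shows "measure lebesgue (K + halfspace_simplex g (\<lambda>_. 0) t) \<le>
    (t + (supp_fun K (g One) + (\<Sum>i\<in>Basis. supp_fun K (- g i)))) ^ DIM('a) *
    measure lebesgue (halfspace_simplex g (\<lambda>_. 0) 1)"
proof -
  let ?Q = "halfspace_simplex g (\<lambda>i. - supp_fun K (- g i)) (supp_fun K (g One) + t)"
  have lt: "(\<Sum>i\<in>Basis. - supp_fun K (- g i)) < supp_fun K (g One) + t"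
    using supp_fun_sum_nonneg[OF g(1) K] t by (simp add: sum_negf)
  have "K + halfspace_simplex g (\<lambda>_. 0) t \<subseteq> ?Q"
  proof
    fix z assume "z \<in> K + halfspace_simplex g (\<lambda>_. 0) t"
    then obtain x y where z: "z = x + y" "x \<in> K" "y \<in> halfspace_simplex g (\<lambda>_. 0) t"
      by (auto simp: set_plus_def)
    have "- supp_fun K (- g i) \<le> z \<bullet> g i" if "i \<in> Basis" for i
      using supp_fun_upper[OF K(1) z(2), of "- g i"] z that
      by (auto simp: halfspace_simplex_def inner_add_left intro: add_increasing2)
    moreover have "z \<bullet> g One \<le> supp_fun K (g One) + t"
      using supp_fun_upper[OF K(1) z(2), of "g One"] z
      by (auto simp: halfspace_simplex_def inner_add_left)
    ultimately show "z \<in> ?Q"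
      by (simp add: halfspace_simplex_def)
  qed
  moreover have "compact (halfspace_simplex g (\<lambda>_. 0) t)"
    using simplex_halfspace_simplex[OF g t] by (rule compact_simplex)
  ultimately have "measure lebesgue (K + halfspace_simplex g (\<lambda>_. 0) t) \<le> measure lebesgue ?Q"
    using K compact_halfspace_simplex[OF g lt]
    by (intro measure_mono_fmeasurable) (auto intro: lmeasurable_compact compact_set_plus fmeasurableD)
  then show ?thesis
    unfolding measure_halfspace_simplex[OF g lt] by (simp add: sum_negf add_ac)
qed

text \<open>The petals \<open>E i - C\<close> are pairwise disjoint and disjoint from the kernel
  \<open>C\<close>. Joining \<open>C\<close> explicitly makes the formula cover empty
  \<open>I\<close> too.\<close>

lemma measure_sunflower:
  assumes "finite I" "C \<in> fmeasurable M"
    and "\<And>i. i \<in> I \<Longrightarrow> E i \<in> fmeasurable M" "\<And>i. i \<in> I \<Longrightarrow> C \<subseteq> E i"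
    and "\<And>i j. i \<in> I \<Longrightarrow> j \<in> I \<Longrightarrow> i \<noteq> j \<Longrightarrow> E i \<inter> E j \<subseteq> C"
  shows "measure M (C \<union> (\<Union>i\<in>I. E i)) = measure M C + (\<Sum>i\<in>I. measure M (E i) - measure M C)"
proof -
  have dm: "E i - C \<in> fmeasurable M" if "i \<in> I" for i
    using assms that by (intro fmeasurable_Diff) auto
  then have um: "(\<Union>i\<in>I. E i - C) \<in> fmeasurable M"
    using assms(1) by (intro fmeasurable.finite_UN) auto
  have "C \<union> (\<Union>i\<in>I. E i) = C \<union> (\<Union>i\<in>I. E i - C)"
    by auto
  also have "measure M \<dots> = measure M C + measure M (\<Union>i\<in>I. E i - C)"
    using assms(2) um
    by (intro measure_Union) (auto simp del: UN_simps dest: fmeasurableD fmeasurableD2)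
  also have "measure M (\<Union>i\<in>I. E i - C) = (\<Sum>i\<in>I. measure M (E i - C))"
    using assms(1,5) dm by (intro measure_finite_Union)
      (auto simp: disjoint_family_on_def fmeasurableD2[OF dm])
  also have "\<dots> = (\<Sum>i\<in>I. measure M (E i) - measure M C)"
    using assms by (intro sum.cong refl measure_Diff) (auto dest: fmeasurableD2)
  finally show ?thesis .
qed

text \<open>The constant \<open>s\<close> does not depend on \<open>t\<close>. Expanding in
  \<open>t\<close> with n = \<open>DIM('a)\<close>, the factor in front of the volume starts with
  t^n + n S t^(n-1), since the contributions of \<open>s\<close> to the second coefficient cancel;
  the upper bound (t + S)^n has the same two leading terms.\<close>

lemma measure_plus_simplex_ge:
  fixes g :: "'a::euclidean_space \<Rightarrow> 'a" and K :: "'a set" and S :: real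
  assumes g: "linear g" "inj g" and K: "compact K" "K \<noteq> {}"
  defines "S \<equiv> supp_fun K (g One) + (\<Sum>i\<in>Basis. supp_fun K (- g i))"
  obtains s :: real where "\<And>t. 0 < t \<Longrightarrow> (DIM('a) + 1) * s < t + S \<Longrightarrow>
    ((DIM('a) + 1) * (t + S - DIM('a) * s) ^ DIM('a) - DIM('a) * (t + S - (DIM('a) + 1) * s) ^ DIM('a)) *
      measure lebesgue (halfspace_simplex g (\<lambda>_. 0) 1)
    \<le> measure lebesgue (K + halfspace_simplex g (\<lambda>_. 0) t)"
proof -
  let ?n = "real DIM('a)"
  define V where "V = measure lebesgue (halfspace_simplex g (\<lambda>_. 0) 1)"
  define m where "m i = - supp_fun K (- g i)" for i
  define M where "M = supp_fun K (g One)"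
  have S: "S = M - sum m Basis"
    by (simp add: S_def M_def m_def sum_negf)
  obtain R where R: "\<And>x. x \<in> K \<Longrightarrow> norm x \<le> R" "0 < R"
    using compact_imp_bounded[OF K(1)] unfolding bounded_pos by blast
  define G where "G = (\<Sum>i\<in>insert One Basis. norm (g i))"
  \<comment> \<open>Diameter bound times a bound on the normals: no functional given by a normal
    varies by more than \<open>s\<close> on \<open>K\<close>.\<close>
  define s where "s = 2 * R * G"
  have normg: "norm (g i) \<le> G" if "i \<in> insert One Basis" for i
    unfolding G_def using that by (intro member_le_sum) auto
  have "0 \<le> s"
    using R(2) unfolding s_def G_def by (intro mult_nonneg_nonneg sum_nonneg) auto
  have s: "x \<bullet> g i \<le> y \<bullet> g i + s" if "x \<in> K" "y \<in> K" "i \<in> insert One Basis" for x y i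
  proof -
    have "(x - y) \<bullet> g i \<le> norm (x - y) * norm (g i)"
      by (rule norm_cauchy_schwarz)
    also have "\<dots> \<le> (2 * R) * G"
    proof (rule mult_mono)
      show "norm (x - y) \<le> 2 * R"
        using R(1)[OF that(1)] R(1)[OF that(2)] norm_triangle_ineq4[of x y] by linarith
    qed (use normg[OF that(3)] R(2) in auto)
    finally show ?thesis
      by (simp add: inner_diff_left s_def)
  qed
  show thesis
  proof
    fix t :: real
    assume t: "0 < t" "(DIM('a) + 1) * s < t + S"
    \<comment> \<open>\<open>E k\<close> lies in the translate of the simplex that touches facet \<open>k\<close> of the circumscribed simplex
      (\<open>None\<close> is the facet with normal \<open>g One\<close>); any two of these regions meet exactly in \<open>C\<close>.\<close>
    define C where "C = halfspace_simplex g (\<lambda>j. m j + s) (M + t - s)"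
    define E where "E k = (case k of None \<Rightarrow> halfspace_simplex g (\<lambda>j. m j + s) (M + t)
      | Some i \<Rightarrow> halfspace_simplex g (\<lambda>j. if j = i then m j else m j + s) (M + t - s))" for k
    define I where "I = insert None (Some ` (Basis :: 'a set))"
    have I: "finite I" "card I = DIM('a) + 1"
      by (auto simp: I_def card_image)
    have sums: "(\<Sum>j\<in>Basis. m j + s) = sum m Basis + ?n * s"
      by (simp add: sum.distrib)
    have sumi: "(\<Sum>j\<in>Basis. if j = i then m j else m j + s) = sum m Basis + (?n - 1) * s"
      if "i \<in> Basis" for i
    proof -
      have "(\<Sum>j\<in>Basis. if j = i then m j else m j + s) = (\<Sum>j\<in>Basis. (m j + s) - (if j = i then s else 0))"
        by (intro sum.cong) auto
      also have "\<dots> = sum m Basis + ?n * s - s"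
        using that by (simp add: sum_subtractf sums)
      finally show ?thesis by (simp add: algebra_simps)
    qed
    \<comment> \<open>The circumscribed simplex has scaling ratio \<open>t + S\<close>. Moving a
      facet inward by \<open>s\<close> lowers the ratio by \<open>s\<close>: \<open>C\<close> moves
      all n + 1 facets, each \<open>E k\<close> all but one. The assumption on \<open>t\<close>
      keeps the smallest ratio positive.\<close>
    have ltC: "(\<Sum>j\<in>Basis. m j + s) < M + t - s"
      using t(2) unfolding sums S by (simp add: algebra_simps)
    have ltN: "(\<Sum>j\<in>Basis. m j + s) < M + t"
      using ltC \<open>0 \<le> s\<close> by linarith
    have ltS: "(\<Sum>j\<in>Basis. if j = i then m j else m j + s) < M + t - s" if "i \<in> Basis" for i
      using ltC \<open>0 \<le> s\<close> unfolding sumi[OF that] sums by (simp add: algebra_simps)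
    have eqC: "M + t - s - (sum m Basis + ?n * s) = t + S - (?n + 1) * s"
      by (simp add: S algebra_simps)
    have C: "C \<in> lmeasurable" "measure lebesgue C = (t + S - (?n + 1) * s) ^ DIM('a) * V"
      using compact_halfspace_simplex[OF g ltC] measure_halfspace_simplex[OF g ltC]
      unfolding sums eqC C_def V_def by (simp_all add: lmeasurable_compact)
    have E: "compact (E k) \<and> measure lebesgue (E k) = (t + S - ?n * s) ^ DIM('a) * V" if "k \<in> I" for k
    proof (cases k)
      case None
      have eqN: "M + t - (sum m Basis + ?n * s) = t + S - ?n * s"
        by (simp add: S)
      show ?thesis
        using None compact_halfspace_simplex[OF g ltN] measure_halfspace_simplex[OF g ltN]
        unfolding sums eqN E_def V_def by simp
    next
      case (Some i)
      with that have i: "i \<in> Basis" by (auto simp: I_def)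
      have eqS: "M + t - s - (sum m Basis + (?n - 1) * s) = t + S - ?n * s"
        by (simp add: S algebra_simps)
      show ?thesis
        using Some compact_halfspace_simplex[OF g ltS[OF i]] measure_halfspace_simplex[OF g ltS[OF i]]
        unfolding sumi[OF i] eqS E_def V_def by simp
    qed
    have CE: "C \<subseteq> E k" for k
    proof
      fix z assume z: "z \<in> C"
      then have "m j + s \<le> z \<bullet> g j" "m j \<le> z \<bullet> g j" if "j \<in> Basis" for j
        using that \<open>0 \<le> s\<close> unfolding C_def halfspace_simplex_def by force+
      moreover have "z \<bullet> g One \<le> M + t - s" "z \<bullet> g One \<le> M + t"
        using z \<open>0 \<le> s\<close> unfolding C_def halfspace_simplex_def by auto
      ultimately show "z \<in> E k"
        by (simp add: E_def halfspace_simplex_def split: option.split)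
    qed
    \<comment> \<open>Each constraint of \<open>C\<close> can fail in only one of the regions, so a
      point of two different regions satisfies all of them.\<close>
    have E_side: "m j + s \<le> z \<bullet> g j" if "z \<in> E k" "k \<noteq> Some j" "j \<in> Basis" for z k j
      using that by (auto simp: E_def halfspace_simplex_def split: option.splits)
    have E_top: "z \<bullet> g One \<le> M + t - s" if "z \<in> E k" "k \<noteq> None" for z k
      using that by (auto simp: E_def halfspace_simplex_def split: option.splits)
    have EE: "E k \<inter> E l \<subseteq> C" if "k \<noteq> l" for k l
    proof
      fix z assume z: "z \<in> E k \<inter> E l"
      have "m j + s \<le> z \<bullet> g j" if "j \<in> Basis" for j
        using z \<open>k \<noteq> l\<close> that E_side[of z k j] E_side[of z l j] by auto
      moreover have "z \<bullet> g One \<le> M + t - s"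
        using z \<open>k \<noteq> l\<close> E_top[of z k] E_top[of z l] by (metis IntD1 IntD2)
      ultimately show "z \<in> C"
        by (simp add: C_def halfspace_simplex_def)
    qed
    have low: "x \<bullet> g j \<le> m j + s" if x: "x \<in> K" and j: "j \<in> Basis" for x j
    proof -
      obtain y where "y \<in> K" "y \<bullet> (- g j) = supp_fun K (- g j)"
        using supp_fun_attained[OF K] by metis
      then show ?thesis
        using s[OF x, of y j] j by (simp add: m_def)
    qed
    have EK: "E k \<subseteq> K + halfspace_simplex g (\<lambda>_. 0) t" if k: "k \<in> I" for k
    proof
      fix z assume z: "z \<in> E k"
      \<comment> \<open>Take \<open>x\<close> in \<open>K\<close> where the support value for facet
        \<open>k\<close> is attained: this constraint is exact, and the others lose at most
        \<open>s\<close>, the margin built into \<open>E k\<close>.\<close>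
      have "\<exists>x\<in>K. (\<forall>j\<in>Basis. x \<bullet> g j \<le> z \<bullet> g j) \<and> z \<bullet> g One \<le> x \<bullet> g One + t"
      proof (cases k)
        case None
        obtain x where x: "x \<in> K" "x \<bullet> g One = M"
          using supp_fun_attained[OF K] unfolding M_def by metis
        then show ?thesis
          using z None low[OF x(1)] by (intro bexI[of _ x]) (auto simp: E_def halfspace_simplex_def intro: order_trans)
      next
        case (Some i)
        with k have i: "i \<in> Basis" by (auto simp: I_def)
        obtain x where x: "x \<in> K" "x \<bullet> (- g i) = supp_fun K (- g i)"
          using supp_fun_attained[OF K] by metis
        have "x \<bullet> g j \<le> m j + s" if "j \<in> Basis" for j
          using low x(1) that .
        moreover have "x \<bullet> g i = m i"
          using x(2) by (simp add: m_def)
        moreover have "M \<le> x \<bullet> g One + s"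
        proof -
          obtain y where "y \<in> K" "y \<bullet> g One = M"
            using supp_fun_attained[OF K] unfolding M_def by metis
          then show ?thesis
            using s[of y x One] x(1) by simp
        qed
        ultimately have "(\<forall>j\<in>Basis. x \<bullet> g j \<le> z \<bullet> g j) \<and> z \<bullet> g One \<le> x \<bullet> g One + t"
          using z Some by (force simp: E_def halfspace_simplex_def split: if_splits)
        with x(1) show ?thesis by blast
      qed
      then obtain x where "x \<in> K" "z - x \<in> halfspace_simplex g (\<lambda>_. 0) t"
        by (auto simp: halfspace_simplex_def inner_diff_left)
      then have "x + (z - x) \<in> K + halfspace_simplex g (\<lambda>_. 0) t"
        by (rule set_plus_intro)
      then show "z \<in> K + halfspace_simplex g (\<lambda>_. 0) t" by simp
    qed
    have meas: "K + halfspace_simplex g (\<lambda>_. 0) t \<in> lmeasurable"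
      using K compact_simplex[OF simplex_halfspace_simplex[OF g t(1)]]
      by (intro lmeasurable_compact compact_set_plus)
    have lm: "E k \<in> lmeasurable" if "k \<in> I" for k
      using E[OF that] lmeasurable_compact by blast
    have "measure lebesgue (C \<union> (\<Union>k\<in>I. E k)) =
        measure lebesgue C + (\<Sum>k\<in>I. measure lebesgue (E k) - measure lebesgue C)"
      using I(1) C(1) lm CE EE by (rule measure_sunflower)
    also have "\<dots> = measure lebesgue C + (?n + 1) * ((t + S - ?n * s) ^ DIM('a) * V - measure lebesgue C)"
      using E I(2) by simp
    also have "\<dots> = ((?n + 1) * (t + S - ?n * s) ^ DIM('a) - ?n * (t + S - (?n + 1) * s) ^ DIM('a)) * V"
      unfolding C(2) by (simp add: algebra_simps)
    finally have eq: "measure lebesgue (C \<union> (\<Union>k\<in>I. E k)) = \<dots>" .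
    have "C \<union> (\<Union>k\<in>I. E k) \<subseteq> K + halfspace_simplex g (\<lambda>_. 0) t"
      using EK CE[of None] unfolding I_def by blast
    moreover have "C \<union> (\<Union>k\<in>I. E k) \<in> lmeasurable"
      using C(1) lm I(1) by (intro fmeasurable.Un fmeasurable.finite_UN)
    ultimately have "measure lebesgue (C \<union> (\<Union>k\<in>I. E k)) \<le> measure lebesgue (K + halfspace_simplex g (\<lambda>_. 0) t)"
      using meas by (intro measure_mono_fmeasurable fmeasurableD)
    then show "(real (DIM('a) + 1) * (t + S - DIM('a) * s) ^ DIM('a) - DIM('a) * (t + S - real (DIM('a) + 1) * s) ^ DIM('a)) *
      measure lebesgue (halfspace_simplex g (\<lambda>_. 0) 1)
      \<le> measure lebesgue (K + halfspace_simplex g (\<lambda>_. 0) t)"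
      unfolding eq V_def by (simp add: add_ac)
  qed
qed

section \<open>Comparison for large simplices and conclusion\<close>

text \<open>Both volume bounds have leading term t^n, and their next coefficients are n times the
  respective support sums. A larger sum for \<open>A\<close> would therefore give
  \<open>A + D\<close> the larger volume for a big simplex \<open>D\<close>.\<close>

lemma supp_fun_sum_le:
  fixes g :: "'a::euclidean_space \<Rightarrow> 'a"
  assumes g: "linear g" "inj g" and A: "compact A" "A \<noteq> {}" and B: "compact B" "B \<noteq> {}"
    and le: "\<And>D. int DIM('a) simplex D \<Longrightarrow> measure lebesgue (A + D) \<le> measure lebesgue (B + D)"
  shows "supp_fun A (g One) + (\<Sum>i\<in>Basis. supp_fun A (- g i)) \<le>
    supp_fun B (g One) + (\<Sum>i\<in>Basis. supp_fun B (- g i))"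
proof (rule ccontr)
  let ?n = "DIM('a)"
  define SA where "SA = supp_fun A (g One) + (\<Sum>i\<in>Basis. supp_fun A (- g i))"
  define SB where "SB = supp_fun B (g One) + (\<Sum>i\<in>Basis. supp_fun B (- g i))"
  assume "\<not> ?thesis"
  then have less: "SB < SA"
    by (simp add: SA_def SB_def)
  obtain s :: real where s: "\<And>t. 0 < t \<Longrightarrow> (?n + 1) * s < t + SA \<Longrightarrow>
    ((?n + 1) * (t + SA - ?n * s) ^ ?n - ?n * (t + SA - (?n + 1) * s) ^ ?n) *
      measure lebesgue (halfspace_simplex g (\<lambda>_. 0) 1)
    \<le> measure lebesgue (A + halfspace_simplex g (\<lambda>_. 0) t)"
    using measure_plus_simplex_ge[OF g A] unfolding SA_def by metis
  define a b where "a = SA - ?n * s" and "b = SA - (?n + 1) * s"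
  have main: "(?n + 1) * (t + a) ^ ?n - ?n * (t + b) ^ ?n \<le> (t + SB) ^ ?n"
    if t: "0 < t" "- b < t" for t
  proof -
    have "int ?n simplex halfspace_simplex g (\<lambda>_. 0) t"
      by (rule simplex_halfspace_simplex[OF g t(1)])
    from le[OF this] measure_plus_simplex_le[OF g B t(1)] s[OF t(1)] t(2)
    have "((?n + 1) * (t + a) ^ ?n - ?n * (t + b) ^ ?n) * measure lebesgue (halfspace_simplex g (\<lambda>_. 0) 1)
      \<le> (t + SB) ^ ?n * measure lebesgue (halfspace_simplex g (\<lambda>_. 0) 1)"
      by (simp add: a_def b_def SB_def add_diff_eq)
    then show ?thesis
      using measure_halfspace_simplex_pos[OF g] mult_right_le_imp_le by blast
  qed
  \<comment> \<open>The substitution x = 1/t moves the comparison at infinity to 0, where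
    \<open>f\<close> vanishes; a positive derivative there contradicts \<open>main\<close>.\<close>
  define f where "f x = (?n + 1) * (1 + a * x) ^ ?n - ?n * (1 + b * x) ^ ?n - (1 + SB * x) ^ ?n" for x :: real
  have "(f has_real_derivative (?n + 1) * (?n * a) - ?n * (?n * b) - ?n * SB) (at 0)"
    unfolding f_def by (auto intro!: derivative_eq_intros)
  also have "(?n + 1) * (?n * a) - ?n * (?n * b) - ?n * SB = ?n * (SA - SB)"
    by (simp add: a_def b_def algebra_simps)
  finally have "(f has_real_derivative ?n * (SA - SB)) (at 0)" .
  moreover have "0 < ?n * (SA - SB)"
    using less by simp
  ultimately obtain d where d: "0 < d" "\<And>h. 0 < h \<Longrightarrow> h < d \<Longrightarrow> f 0 < f (0 + h)"
    using DERIV_pos_inc_right by blast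
  \<comment> \<open>Large enough both for \<open>main\<close> to apply and for \<open>1 / t\<close>
    to be below \<open>d\<close>.\<close>
  define t where "t = max (1 - b) (1 / d + 1)"
  have t: "0 < t" "- b < t" "1 / d < t"
    using zero_less_divide_1_iff[of d] d(1) unfolding t_def by linarith+
  have "0 < f (1 / t)"
    using d(2)[of "1 / t"] t d(1) by (simp add: f_def field_simps)
  moreover have "t ^ ?n * f (1 / t) = (?n + 1) * (t + a) ^ ?n - ?n * (t + b) ^ ?n - (t + SB) ^ ?n"
  proof -
    have "t ^ ?n * (1 + c * (1 / t)) ^ ?n = (t + c) ^ ?n" for c
      using t(1) by (simp add: distrib_left flip: power_mult_distrib)
    then show ?thesis
      unfolding f_def right_diff_distrib by (simp add: mult.left_commute)
  qed
  ultimately have "0 < (?n + 1) * (t + a) ^ ?n - ?n * (t + b) ^ ?n - (t + SB) ^ ?n"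
    using t(1) by (metis mult_pos_pos zero_less_power)
  with main[OF t(1,2)] show False by simp
qed

lemma exists_simplex_witness:
  fixes A B :: "'a::euclidean_space set"
  assumes A: "compact A" "A \<noteq> {}" and B: "compact B" "B \<noteq> {}" "convex B"
    and no: "\<nexists>x0. A \<subseteq> (\<lambda>b. b + x0) ` B"
  obtains D where "int DIM('a) simplex D" "measure lebesgue (B + D) < measure lebesgue (A + D)"
proof -
  define \<phi> where "\<phi> u = supp_fun A u - supp_fun B u" for u
  have hom: "\<phi> (c *\<^sub>R u) = c * \<phi> u" if "0 \<le> c" for c u
    using A B that by (simp add: \<phi>_def supp_fun_scaleR right_diff_distrib)
  have cont: "continuous_on UNIV \<phi>"
    unfolding \<phi>_def using A B by (intro continuous_intros continuous_on_supp_fun)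
  \<comment> \<open>A linear majorant of \<open>\<phi>\<close> would be exactly a translation vector
    taking \<open>B\<close> over \<open>A\<close>.\<close>
  have not_majorized: "\<nexists>x. \<forall>u. \<phi> u \<le> x \<bullet> u"
  proof
    assume "\<exists>x. \<forall>u. \<phi> u \<le> x \<bullet> u"
    then obtain x where "\<And>u. supp_fun A u \<le> supp_fun B u + x \<bullet> u"
      by (auto simp: \<phi>_def diff_le_eq add.commute)
    then have "A \<subseteq> (\<lambda>b. b + x) ` B"
      by (rule subset_translate_if_supp_fun_le[OF A(1) B(1,3,2)])
    with no show False by blast
  qed
  obtain T l where T: "finite T" "\<forall>v\<in>T. 0 \<le> l v" "(\<Sum>v\<in>T. l v *\<^sub>R v) = 0"
      "0 < (\<Sum>v\<in>T. l v * \<phi> v)"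
    by (rule not_linear_majorized_imp_balanced_weights[OF hom not_majorized])
  obtain W k v0 where "independent W" "v0 \<notin> W" "\<forall>v\<in>insert v0 W. 0 < k v"
      "k v0 *\<^sub>R v0 + (\<Sum>v\<in>W. k v *\<^sub>R v) = 0" "0 < k v0 * \<phi> v0 + (\<Sum>v\<in>W. k v * \<phi> v)"
    by (rule independent_balanced_weights[OF T])
  from injective_linear_positive_sum[OF hom cont this]
  obtain g :: "'a \<Rightarrow> 'a" where g: "linear g" "inj g"
      and pos: "0 < \<phi> (g One) + (\<Sum>i\<in>Basis. \<phi> (- g i))"
    by blast
  \<comment> \<open>If no simplex worked, \<open>supp_fun_sum_le\<close> would make the sum in
    \<open>pos\<close> at most zero.\<close>
  have "\<not> (\<forall>D. int DIM('a) simplex D \<longrightarrow> measure lebesgue (A + D) \<le> measure lebesgue (B + D))"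
    using supp_fun_sum_le[OF g A B(1,2)] pos by (fastforce simp: \<phi>_def sum_subtractf)
  then show thesis
    using that by (auto simp: not_le)
qed

theorem theorem1p4:
  fixes A B :: "(real ^ 'n) set"
  assumes "convex_body A" and "convex_body B"
  shows "((\<forall>K :: (real ^ 'n) set. convex_body K \<longrightarrow>
             measure lebesgue (A + K) \<le> measure lebesgue (B + K))
           \<longrightarrow> (\<exists>x0. A \<subseteq> (\<lambda>b. b + x0) ` B))
       \<and> ((\<forall>D :: (real ^ 'n) set. int CARD('n) simplex D \<longrightarrow>
             measure lebesgue (A + D) \<le> measure lebesgue (B + D))
           \<longrightarrow> (\<exists>x0. A \<subseteq> (\<lambda>b. b + x0) ` B))"
proof -
  have A: "compact A" "A \<noteq> {}" and B: "compact B" "B \<noteq> {}" "convex B"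
    using assms by (auto simp: convex_body_def)
  have simplices: "\<exists>x0. A \<subseteq> (\<lambda>b. b + x0) ` B"
    if le: "\<And>D :: (real ^ 'n) set. int CARD('n) simplex D \<Longrightarrow>
      measure lebesgue (A + D) \<le> measure lebesgue (B + D)"
  proof (rule ccontr)
    assume "\<nexists>x0. A \<subseteq> (\<lambda>b. b + x0) ` B"
    then obtain D where "int DIM(real ^ 'n) simplex D" "measure lebesgue (B + D) < measure lebesgue (A + D)"
      using exists_simplex_witness[OF A B] by blast
    then show False
      using le[of D] by simp
  qed
  \<comment> \<open>Simplices are among the convex bodies, so the first claim reduces to the
    second.\<close>
  have "convex_body D" if "int CARD('n) simplex D" for D :: "(real ^ 'n) set"
    using that by (intro simplex_imp_convex_body) simp
  with simplices show ?thesis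
    by blast
qed

end
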